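(* Let $w=w_1w_2\cdots w_n\in\mathfrak S_n$. The Rothe diagram $R_w$ is, up to permuting its rows and columns, the complement of a skew shape if and only if $w$, as a word, can be decomposed as $w=a_1a_2\cdots a_kb_1b_2\cdots b_{n-k}$ for some $0\le k\le n$, where $a_i<b_j$ for all $i$ and $j$, and each of the words $a_1a_2\cdots a_k$ and $b_1b_2\cdots b_{n-k}$ is $2143$-avoiding.
   Context: $[n]=\{1,\dots,n\}$; $\mathfrak S_n$ is the group of permutations of $[n]$, written as words $w=w_1\cdots w_n$ with $w_i=w(i)$. Positions in $[n]\times[n]$ are indexed in matrix coordinates (row, column). The Rothe diagram of $w$ is $$R_w=\{(i,j)\mid 1\le i,j\le n,\ w(i)>j,\ w^{-1}(j)>i\}.$$ For a partition $\lambda$, given by integers $n\ge\lambda_1\ge\cdots\ge\lambda_n\ge0$, $S_\lambda=\{(i,j)\mid 1\le i\le n,\ 1\le j\le\lambda_i\}$. If $\lambda,\mu$ are two such partitions with $S_\mu\subseteq S_\lambda$, the set $S_{\lambda/\mu}=S_\lambda\setminus S_\mu$ is a skew shape; its complement is $([n]\times[n])\setminus S_{\lambda/\mu}$. "Up to permuting rows and columns" means that there are permutations $\sigma,\tau\in\mathfrak S_n$ such that $\{(\sigma(i),\tau(j))\mid (i,j)\in R_w\}$ is the complement of a skew shape in $[n]\times[n]$. A word with distinct integer entries $x_1x_2\cdots x_m$ is $2143$-avoiding if there are no indices $i<j<k<l$ with $x_j<x_i<x_l<x_k$. *)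

theory Defs
  imports "HOL-Combinatorics.Permutations"
begin

text \<open>
  The set \<open>[n]\<close> is \<open>{1..n} :: nat set\<close>. An element of the symmetric group on \<open>[n]\<close> is a
  function \<open>w :: nat \<Rightarrow> nat\<close> with \<open>w permutes {1..n}\<close>. Such a \<open>w\<close> is a bijection of \<^typ>\<open>nat\<close>
  fixing everything outside \<open>[n]\<close>, so \<open>inv w\<close> is the inverse permutation.
\<close>

definition permutation_word :: "nat \<Rightarrow> (nat \<Rightarrow> nat) \<Rightarrow> nat list" where
  "permutation_word n w = map w [1..<Suc n]"

definition rothe_diagram :: "nat \<Rightarrow> (nat \<Rightarrow> nat) \<Rightarrow> (nat \<times> nat) set" where
  "rothe_diagram n w =
     {(i, j). i \<in> {1..n} \<and> j \<in> {1..n} \<and> w i > j \<and> inv w j > i}"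

text \<open>A partition is a function of which only the values on \<open>{1..n}\<close> matter.\<close>

definition is_partition :: "nat \<Rightarrow> (nat \<Rightarrow> nat) \<Rightarrow> bool" where
  "is_partition n lam \<longleftrightarrow>
     (\<forall>i\<in>{1..n}. lam i \<le> n) \<and>
     (\<forall>i\<in>{1..n}. \<forall>j\<in>{1..n}. i \<le> j \<longrightarrow> lam j \<le> lam i)"

definition partition_shape :: "nat \<Rightarrow> (nat \<Rightarrow> nat) \<Rightarrow> (nat \<times> nat) set" where
  "partition_shape n lam = {(i, j). 1 \<le> i \<and> i \<le> n \<and> 1 \<le> j \<and> j \<le> lam i}"

definition is_skew_shape :: "nat \<Rightarrow> (nat \<times> nat) set \<Rightarrow> bool" where
  "is_skew_shape n S \<longleftrightarrow>
     (\<exists>lam mu. is_partition n lam \<and> is_partition n mu \<and>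
        partition_shape n mu \<subseteq> partition_shape n lam \<and>
        S = partition_shape n lam - partition_shape n mu)"

definition is_skew_complement :: "nat \<Rightarrow> (nat \<times> nat) set \<Rightarrow> bool" where
  "is_skew_complement n D \<longleftrightarrow>
     (\<exists>S. is_skew_shape n S \<and> D = {1..n} \<times> {1..n} - S)"

definition skew_complement_up_to_perm :: "nat \<Rightarrow> (nat \<times> nat) set \<Rightarrow> bool" where
  "skew_complement_up_to_perm n D \<longleftrightarrow>
     (\<exists>\<sigma> \<tau>. \<sigma> permutes {1..n} \<and> \<tau> permutes {1..n} \<and>
        is_skew_complement n {(\<sigma> i, \<tau> j) | i j. (i, j) \<in> D})"

text \<open>Indices into the list start at 0, which does not affect the relative order of positions.\<close>

definition avoids_2143 :: "'a::linorder list \<Rightarrow> bool" where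
  "avoids_2143 x \<longleftrightarrow>
     \<not> (\<exists>i j k l. i < j \<and> j < k \<and> k < l \<and> l < length x \<and>
          x ! j < x ! i \<and> x ! i < x ! l \<and> x ! l < x ! k)"

end

theory Submission
  imports Defs
begin

text \<open>
  A cell \<open>(i, w q)\<close> of the Rothe diagram is the same thing as an inversion \<open>(i, q)\<close> of \<open>w\<close>, that
  is, \<open>i < q\<close> and \<open>w q < w i\<close>. So, after permuting columns by \<open>w\<close>, the Rothe diagram becomes the
  set of inversions regarded as a relation on positions (\<open>skew_complement_rothe_iff\<close>).

  The complement of a skew shape consists of a Young diagram in the north-west corner and another
  one in the south-east corner. Up to permuting rows and columns, a set of cells is a Young diagram
  iff its rows form a chain under inclusion, i.e. iff it is a Ferrers relation. The two corners may
  share rows and columns in general. They cannot do so when some row and some column are empty,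
  because the empty row and column then separate the corners; and the inversion relation has no
  inversion starting at the last position and none ending at the first. Hence the Rothe diagram
  is a skew complement up to permutation iff the set of inversions splits into two Ferrers
  relations \<open>A\<close> and \<open>B\<close> with disjoint domains and disjoint ranges
  (\<open>skew_complement_if_ferrers_union\<close>, \<open>ferrers_union_if_skew_complement\<close>).

  Two inversions violate the Ferrers condition exactly when they are the \<open>21\<close> and the \<open>43\<close> of an
  occurrence of \<open>2143\<close> (\<open>ferrers_inversions_iff_avoids\<close>). If \<open>w = ab\<close> as in the theorem, then
  there is no inversion between \<open>a\<close> and \<open>b\<close>, and the inversions of \<open>a\<close> and those of \<open>b\<close> are the
  two Ferrers relations sought. Conversely, disjointness of the domains and of the ranges forces
  all inversions touching a given position to lie in the same part, so that each connected
  component of the inversion graph lies in \<open>A\<close> or in \<open>B\<close>. The Ferrers condition permits only one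
  component with inversions in each part. Components are intervals of positions, so cutting \<open>w\<close> at the end of the
  first one gives \<open>a\<close> and \<open>b\<close> (\<open>inversions_cut\<close>).
\<close>

section \<open>Ferrers relations\<close>

definition ferrers :: "('a \<times> 'b) set \<Rightarrow> bool" where
  "ferrers R \<longleftrightarrow>
     (\<forall>i j i' j'. (i, j) \<in> R \<longrightarrow> (i', j') \<in> R \<longrightarrow> (i, j') \<in> R \<or> (i', j) \<in> R)"

lemma ferrersD:
  "ferrers R \<Longrightarrow> (i, j) \<in> R \<Longrightarrow> (i', j') \<in> R \<Longrightarrow> (i, j') \<in> R \<or> (i', j) \<in> R"
  unfolding ferrers_def by blast

lemma ferrers_converse: "ferrers R \<Longrightarrow> ferrers (R\<inverse>)"
  unfolding ferrers_def by blast

text \<open>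
  The rows of a Ferrers relation form a chain, so they are compared by their sizes. This is what
  allows the rows to be put in order by sorting numbers.
\<close>

lemma ferrers_row_mono:
  assumes "ferrers R" "finite R" "(i, j) \<in> R" "card (R `` {i}) \<le> card (R `` {i'})"
  shows "(i', j) \<in> R"
proof (rule ccontr)
  assume nin: "(i', j) \<notin> R"
  have "R `` {i'} \<subset> R `` {i}"
    using ferrersD[OF assms(1,3)] assms(3) nin by blast
  moreover have "finite (R `` {i})"
    using assms(2) by (rule finite_Image)
  ultimately have "card (R `` {i'}) < card (R `` {i})"
    by (rule psubset_card_mono[rotated])
  then show False
    using assms(4) by simp
qed

text \<open>
  For \<open>A\<close> and \<open>B\<close> with disjoint domains, this one key sorts the rows of \<open>A\<close> by decreasing size to
  the front (negative keys) and those of \<open>B\<close> by increasing size to the back (positive keys).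
\<close>

definition row_key :: "('a \<times> 'b) set \<Rightarrow> ('a \<times> 'b) set \<Rightarrow> 'a \<Rightarrow> int" where
  "row_key A B i = int (card (B `` {i})) - int (card (A `` {i}))"

lemma row_key_le_imp_mem:
  assumes "ferrers A" "finite A" "Domain A \<inter> Domain B = {}"
    and "(i, j) \<in> A" "row_key A B i' \<le> row_key A B i"
  shows "(i', j) \<in> A"
proof -
  have "B `` {i} = {}"
    using assms(3,4) by blast
  then have "card (A `` {i}) \<le> card (A `` {i'})"
    using assms(5) by (simp add: row_key_def)
  then show ?thesis
    using ferrers_row_mono assms(1,2,4) by metis
qed

lemma row_key_commute: "row_key B A i = - row_key A B i"
  by (simp add: row_key_def)

section \<open>Partition shapes and sorting permutations\<close>

lemma partition_shape_if_down_closed: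
  assumes sub: "X \<subseteq> {1..n} \<times> {1..n}"
    and down: "\<And>x y x' y'. (x, y) \<in> X \<Longrightarrow> 1 \<le> x' \<Longrightarrow> x' \<le> x \<Longrightarrow> 1 \<le> y' \<Longrightarrow> y' \<le> y \<Longrightarrow> (x', y') \<in> X"
  shows "\<exists>mu. is_partition n mu \<and> partition_shape n mu = X"
proof (intro exI conjI)
  define mu where "mu x = Max (insert 0 (X `` {x}))" for x
  have fin: "finite (X `` {x})" for x
    using finite_subset[OF sub] by (simp add: finite_Image)
  have mem: "(x, y) \<in> X \<longleftrightarrow> 1 \<le> x \<and> x \<le> n \<and> 1 \<le> y \<and> y \<le> mu x" for x y
  proof
    assume "(x, y) \<in> X"
    then show "1 \<le> x \<and> x \<le> n \<and> 1 \<le> y \<and> y \<le> mu x"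
      using sub fin by (auto simp: mu_def intro!: Max_ge)
  next
    assume *: "1 \<le> x \<and> x \<le> n \<and> 1 \<le> y \<and> y \<le> mu x"
    have "mu x \<in> insert 0 (X `` {x})"
      unfolding mu_def using fin by (intro Max_in) auto
    with * have "(x, mu x) \<in> X"
      by auto
    with * show "(x, y) \<in> X"
      using down by blast
  qed
  show "partition_shape n mu = X"
    using mem by (auto simp: partition_shape_def)
  show "is_partition n mu"
    unfolding is_partition_def
  proof (intro conjI ballI impI)
    fix i assume "i \<in> {1..n}"
    show "mu i \<le> n"
      unfolding mu_def using sub fin by (subst Max_le_iff) auto
  next
    fix i j assume *: "i \<in> {1..n}" "j \<in> {1..n}" "i \<le> j"
    show "mu j \<le> mu i"
    proof (cases "mu j = 0")
      case False
      then have "(j, mu j) \<in> X"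
        using * by (simp add: mem)
      then have "(i, mu j) \<in> X"
        using * False by (auto intro: down)
      then show ?thesis
        by (simp add: mem)
    qed simp
  qed
qed

lemma is_skew_complement_Un:
  assumes "A \<subseteq> {1..n} \<times> {1..n}" "B \<subseteq> {1..n} \<times> {1..n}" "A \<inter> B = {}"
    and downA: "\<And>x y x' y'. (x, y) \<in> A \<Longrightarrow> 1 \<le> x' \<Longrightarrow> x' \<le> x \<Longrightarrow> 1 \<le> y' \<Longrightarrow> y' \<le> y \<Longrightarrow> (x', y') \<in> A"
    and upB: "\<And>x y x' y'. (x, y) \<in> B \<Longrightarrow> x \<le> x' \<Longrightarrow> x' \<le> n \<Longrightarrow> y \<le> y' \<Longrightarrow> y' \<le> n \<Longrightarrow> (x', y') \<in> B"
  shows "is_skew_complement n (A \<union> B)"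
proof -
  have "\<exists>mu. is_partition n mu \<and> partition_shape n mu = A"
    by (rule partition_shape_if_down_closed[OF assms(1)]) (rule downA)
  then obtain mu where mu: "is_partition n mu" "partition_shape n mu = A"
    by blast
  have "\<exists>lam. is_partition n lam \<and> partition_shape n lam = {1..n} \<times> {1..n} - B"
  proof (rule partition_shape_if_down_closed)
    fix x y x' y'
    assume "(x, y) \<in> {1..n} \<times> {1..n} - B" "1 \<le> x'" "x' \<le> x" "1 \<le> y'" "y' \<le> y"
    then show "(x', y') \<in> {1..n} \<times> {1..n} - B"
      using upB[of x' y' x y] by auto
  qed auto
  then obtain lam where lam: "is_partition n lam" "partition_shape n lam = {1..n} \<times> {1..n} - B"
    by blast
  have "is_skew_shape n (partition_shape n lam - partition_shape n mu)"
    unfolding is_skew_shape_def using mu lam assms(1,3) by blast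
  moreover have "A \<union> B = {1..n} \<times> {1..n} - (partition_shape n lam - partition_shape n mu)"
    using mu lam assms(1-3) by auto
  ultimately show ?thesis
    unfolding is_skew_complement_def by blast
qed

lemma exists_sorting_permutation:
  fixes f :: "nat \<Rightarrow> 'a::linorder"
  shows "\<exists>\<sigma>. \<sigma> permutes {1..n} \<and>
    (\<forall>i\<in>{1..n}. \<forall>j\<in>{1..n}. \<sigma> i \<le> \<sigma> j \<longrightarrow> f i \<le> f j)"
proof -
  \<comment> \<open>\<open>\<sigma>\<close> is the rank function; ties are broken by position to make it injective.\<close>
  define below where "below i = {j \<in> {1..n}. f j < f i \<or> f j = f i \<and> j \<le> i}" for i
  define \<sigma> where "\<sigma> i = (if i \<in> {1..n} then card (below i) else i)" for i
  have less: "\<sigma> i < \<sigma> j"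
    if "i \<in> {1..n}" "j \<in> {1..n}" "f i < f j \<or> f i = f j \<and> i < j" for i j
  proof -
    have "below i \<subseteq> below j" "j \<in> below j" "j \<notin> below i"
      using that by (auto simp: below_def)
    then have "card (below i) < card (below j)"
      by (intro psubset_card_mono) (auto simp: below_def)
    then show ?thesis
      using that by (simp add: \<sigma>_def)
  qed
  have inj: "inj_on \<sigma> {1..n}"
  proof (rule inj_onI, rule ccontr)
    fix i j assume *: "i \<in> {1..n}" "j \<in> {1..n}" "\<sigma> i = \<sigma> j" "i \<noteq> j"
    then have "(f i < f j \<or> f i = f j \<and> i < j) \<or> (f j < f i \<or> f j = f i \<and> j < i)"
      by auto
    then show False
      using less[of i j] less[of j i] * by auto
  qed
  have "\<sigma> i \<in> {1..n}" if "i \<in> {1..n}" for i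
  proof -
    have "card (below i) \<le> card {1..n}"
      by (rule card_mono) (auto simp: below_def)
    moreover have "card (below i) > 0"
      using that by (auto simp: card_gt_0_iff below_def)
    ultimately show ?thesis
      using that by (simp add: \<sigma>_def)
  qed
  then have "\<sigma> ` {1..n} = {1..n}"
    using inj by (intro endo_inj_surj) auto
  then have "\<sigma> permutes {1..n}"
    using inj by (intro bij_imp_permutes) (auto simp: bij_betw_def \<sigma>_def)
  moreover have "\<forall>i\<in>{1..n}. \<forall>j\<in>{1..n}. \<sigma> i \<le> \<sigma> j \<longrightarrow> f i \<le> f j"
    using less by (meson not_le)
  ultimately show ?thesis
    by blast
qed

section \<open>Skew complements as pairs of Ferrers relations\<close>

lemma skew_complement_if_ferrers_union:
  assumes sub: "A \<union> B \<subseteq> {1..n} \<times> {1..n}"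
    and fer: "ferrers A" "ferrers B"
    and dom: "Domain A \<inter> Domain B = {}" and ran: "Range A \<inter> Range B = {}"
  shows "skew_complement_up_to_perm n (A \<union> B)"
proof -
  have fin: "finite A" "finite B"
    using sub finite_subset[of _ "{1..n} \<times> {1..n}"] by auto
  obtain \<sigma> where \<sigma>: "\<sigma> permutes {1..n}"
    and \<sigma>_key: "\<And>i j. i \<in> {1..n} \<Longrightarrow> j \<in> {1..n} \<Longrightarrow> \<sigma> i \<le> \<sigma> j \<Longrightarrow> row_key A B i \<le> row_key A B j"
    using exists_sorting_permutation[of n "row_key A B"] by blast
  obtain \<tau> where \<tau>: "\<tau> permutes {1..n}"
    and \<tau>_key: "\<And>i j. i \<in> {1..n} \<Longrightarrow> j \<in> {1..n} \<Longrightarrow> \<tau> i \<le> \<tau> j \<Longrightarrow>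
      row_key (A\<inverse>) (B\<inverse>) i \<le> row_key (A\<inverse>) (B\<inverse>) j"
    using exists_sorting_permutation[of n "row_key (A\<inverse>) (B\<inverse>)"] by blast
  let ?A = "map_prod \<sigma> \<tau> ` A" and ?B = "map_prod \<sigma> \<tau> ` B"
  have bij: "bij \<sigma>" "bij \<tau>"
    using \<sigma> \<tau> by (auto intro: permutes_bij)
  then have inj: "inj (map_prod \<sigma> \<tau>)"
    by (auto simp: bij_def intro: map_prod_inj_on[of _ UNIV _ UNIV, simplified])
  have pre: "\<exists>i\<in>{1..n}. \<rho> i = x" if "\<rho> permutes {1..n}" "x \<in> {1..n}" for \<rho> x
    using permutes_image[OF that(1)] that(2) by (metis imageE)
  have A_closed: "(i', j') \<in> A"
    if "(i, j) \<in> A" "i' \<in> {1..n}" "j' \<in> {1..n}" "\<sigma> i' \<le> \<sigma> i" "\<tau> j' \<le> \<tau> j" for i j i' j'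
  proof -
    have ij: "i \<in> {1..n}" "j \<in> {1..n}"
      using that sub by auto
    have "(i', j) \<in> A"
      using row_key_le_imp_mem[OF fer(1) fin(1) dom that(1)] \<sigma>_key that ij by blast
    then have "(j', i') \<in> A\<inverse>"
      using row_key_le_imp_mem[of "A\<inverse>" "B\<inverse>" j i' j'] ferrers_converse[OF fer(1)] fin ran
        \<tau>_key that ij by auto
    then show ?thesis
      by simp
  qed
  have B_closed: "(i', j') \<in> B"
    if "(i, j) \<in> B" "i' \<in> {1..n}" "j' \<in> {1..n}" "\<sigma> i \<le> \<sigma> i'" "\<tau> j \<le> \<tau> j'" for i j i' j'
  proof -
    have ij: "i \<in> {1..n}" "j \<in> {1..n}"
      using that sub by auto
    have "row_key B A i' \<le> row_key B A i"
      using \<sigma>_key that ij by (simp add: row_key_commute[of B A])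
    then have "(i', j) \<in> B"
      using row_key_le_imp_mem[OF fer(2) fin(2) _ that(1)] dom by blast
    moreover have "row_key (B\<inverse>) (A\<inverse>) j' \<le> row_key (B\<inverse>) (A\<inverse>) j"
      using \<tau>_key that ij by (simp add: row_key_commute[of "B\<inverse>" "A\<inverse>"])
    ultimately have "(j', i') \<in> B\<inverse>"
      using row_key_le_imp_mem[of "B\<inverse>" "A\<inverse>" j i' j'] ferrers_converse[OF fer(2)] fin ran
      by auto
    then show ?thesis
      by simp
  qed
  have in_n: "\<sigma> i \<in> {1..n}" "\<tau> j \<in> {1..n}" if "(i, j) \<in> A \<union> B" for i j
    using subsetD[OF sub that]
    by (simp_all only: permutes_in_image[OF \<sigma>] permutes_in_image[OF \<tau>] mem_Sigma_iff)
  have "is_skew_complement n (?A \<union> ?B)"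
  proof (rule is_skew_complement_Un)
    show "?A \<subseteq> {1..n} \<times> {1..n}" "?B \<subseteq> {1..n} \<times> {1..n}"
      using in_n by fastforce+
    have "A \<inter> B = {}"
      using dom by auto
    then show "?A \<inter> ?B = {}"
      using inj by (metis image_Int image_empty)
  next
    fix x y x' y'
    assume *: "(x, y) \<in> ?A" "1 \<le> x'" "x' \<le> x" "1 \<le> y'" "y' \<le> y"
    then obtain i j where ij: "(i, j) \<in> A" "x = \<sigma> i" "y = \<tau> j"
      by auto
    then have "x' \<in> {1..n}" "y' \<in> {1..n}"
      using * in_n[of i j] by auto
    then obtain i' j' where "i' \<in> {1..n}" "\<sigma> i' = x'" "j' \<in> {1..n}" "\<tau> j' = y'"
      using pre[OF \<sigma>] pre[OF \<tau>] by blast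
    then show "(x', y') \<in> ?A"
      using A_closed[OF ij(1)] * ij by force
  next
    fix x y x' y'
    assume *: "(x, y) \<in> ?B" "x \<le> x'" "x' \<le> n" "y \<le> y'" "y' \<le> n"
    then obtain i j where ij: "(i, j) \<in> B" "x = \<sigma> i" "y = \<tau> j"
      by auto
    then have "x' \<in> {1..n}" "y' \<in> {1..n}"
      using * in_n[of i j] by auto
    then obtain i' j' where "i' \<in> {1..n}" "\<sigma> i' = x'" "j' \<in> {1..n}" "\<tau> j' = y'"
      using pre[OF \<sigma>] pre[OF \<tau>] by blast
    then show "(x', y') \<in> ?B"
      using B_closed[OF ij(1)] * ij by force
  qed
  moreover have "?A \<union> ?B = {(\<sigma> i, \<tau> j) | i j. (i, j) \<in> A \<union> B}"
    by force
  ultimately show ?thesis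
    unfolding skew_complement_up_to_perm_def using \<sigma> \<tau> by auto
qed

text \<open>
  An empty row has a position in the sorted order. A row meeting the north-west diagram is longer
  there than the empty row, hence comes before it; a row meeting the south-east diagram comes after
  it. So no row meets both diagrams, and likewise for columns.
\<close>

lemma ferrers_union_if_skew_complement:
  assumes skew: "skew_complement_up_to_perm n D"
    and sub: "D \<subseteq> {1..n} \<times> {1..n}"
    and row: "i0 \<in> {1..n}" "i0 \<notin> Domain D"
    and col: "j0 \<in> {1..n}" "j0 \<notin> Range D"
  shows "\<exists>A B. D = A \<union> B \<and> ferrers A \<and> ferrers B \<and>
    Domain A \<inter> Domain B = {} \<and> Range A \<inter> Range B = {}"
proof -
  obtain \<sigma> \<tau> S where \<sigma>: "\<sigma> permutes {1..n}" and \<tau>: "\<tau> permutes {1..n}"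
    and S: "is_skew_shape n S" and eq: "{(\<sigma> i, \<tau> j) | i j. (i, j) \<in> D} = {1..n} \<times> {1..n} - S"
    using skew unfolding skew_complement_up_to_perm_def is_skew_complement_def by blast
  obtain lam mu where lam: "is_partition n lam" and mu: "is_partition n mu"
    and S_eq: "S = partition_shape n lam - partition_shape n mu"
    using S unfolding is_skew_shape_def by blast
  have in_n: "\<sigma> i \<in> {1..n}" "\<tau> i \<in> {1..n}" if "i \<in> {1..n}" for i
    using that by (simp_all only: permutes_in_image[OF \<sigma>] permutes_in_image[OF \<tau>])
  have mem: "(i, j) \<in> D \<longleftrightarrow> \<tau> j \<le> mu (\<sigma> i) \<or> lam (\<sigma> i) < \<tau> j"
    if "i \<in> {1..n}" "j \<in> {1..n}" for i j
  proof -
    have "(i, j) \<in> D \<longleftrightarrow> (\<sigma> i, \<tau> j) \<in> {(\<sigma> i, \<tau> j) | i j. (i, j) \<in> D}"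
      using permutes_inj[OF \<sigma>] permutes_inj[OF \<tau>] by (auto simp: inj_eq)
    also have "\<dots> \<longleftrightarrow> \<tau> j \<le> mu (\<sigma> i) \<or> lam (\<sigma> i) < \<tau> j"
      unfolding eq S_eq partition_shape_def using in_n[of i] in_n[of j] that by auto
    finally show ?thesis .
  qed
  have mu_anti: "mu (\<sigma> i') \<le> mu (\<sigma> i)" and lam_anti: "lam (\<sigma> i') \<le> lam (\<sigma> i)"
    if "i \<in> {1..n}" "i' \<in> {1..n}" "\<sigma> i \<le> \<sigma> i'" for i i'
    using lam mu in_n that unfolding is_partition_def by blast+
  have empty_col: "mu (\<sigma> i) < \<tau> j0 \<and> \<tau> j0 \<le> lam (\<sigma> i)" if "i \<in> {1..n}" for i
    using mem[OF that col(1)] col(2) by (meson Range.intros not_le)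
  have empty_row: "mu (\<sigma> i0) < \<tau> j \<and> \<tau> j \<le> lam (\<sigma> i0)" if "j \<in> {1..n}" for j
    using mem[OF row(1) that] row(2) by (meson Domain.intros not_le)
  define A where "A = {(i, j) \<in> D. \<tau> j \<le> mu (\<sigma> i)}"
  define B where "B = {(i, j) \<in> D. lam (\<sigma> i) < \<tau> j}"
  have D_n: "i \<in> {1..n}" "j \<in> {1..n}" if "(i, j) \<in> D" for i j
    using that sub by auto
  have "\<tau> j \<le> mu (\<sigma> i) \<or> lam (\<sigma> i) < \<tau> j" if "(i, j) \<in> D" for i j
    using mem[OF D_n[OF that]] that by blast
  then have "D = A \<union> B"
    by (auto simp: A_def B_def)
  moreover have "Domain A \<inter> Domain B = {}"
  proof -
    have "\<sigma> i < \<sigma> i0" if "(i, j) \<in> A" for i j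
    proof (rule ccontr)
      assume "\<not> ?thesis"
      then have "mu (\<sigma> i) \<le> mu (\<sigma> i0)"
        using mu_anti row(1) that D_n by (auto simp: A_def)
      then show False
        using that empty_row[of j] D_n by (auto simp: A_def)
    qed
    moreover have "\<sigma> i0 < \<sigma> i" if "(i, j) \<in> B" for i j
    proof (rule ccontr)
      assume "\<not> ?thesis"
      then have "lam (\<sigma> i0) \<le> lam (\<sigma> i)"
        using lam_anti row(1) that D_n by (auto simp: B_def)
      then show False
        using that empty_row[of j] D_n by (auto simp: B_def)
    qed
    ultimately show ?thesis
      by (blast dest: less_asym)
  qed
  moreover have "Range A \<inter> Range B = {}"
  proof -
    have "\<tau> j < \<tau> j0" if "(i, j) \<in> A" for i j
      using that empty_col[of i] D_n by (auto simp: A_def)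
    moreover have "\<tau> j0 < \<tau> j" if "(i, j) \<in> B" for i j
      using that empty_col[of i] D_n by (auto simp: B_def)
    ultimately show ?thesis
      by (blast dest: less_asym)
  qed
  moreover have "ferrers A"
    unfolding ferrers_def
  proof (intro allI impI)
    fix i j i' j' assume *: "(i, j) \<in> A" "(i', j') \<in> A"
    then have D: "(i, j) \<in> D" "(i', j') \<in> D"
      and le: "\<tau> j \<le> mu (\<sigma> i)" "\<tau> j' \<le> mu (\<sigma> i')"
      by (auto simp: A_def)
    note n = D_n[OF D(1)] D_n[OF D(2)]
    have "\<tau> j' \<le> mu (\<sigma> i) \<or> \<tau> j \<le> mu (\<sigma> i')"
      using mu_anti[of i i'] mu_anti[of i' i] n le by linarith
    then show "(i, j') \<in> A \<or> (i', j) \<in> A"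
      using mem n by (auto simp: A_def)
  qed
  moreover have "ferrers B"
    unfolding ferrers_def
  proof (intro allI impI)
    fix i j i' j' assume *: "(i, j) \<in> B" "(i', j') \<in> B"
    then have D: "(i, j) \<in> D" "(i', j') \<in> D"
      and le: "lam (\<sigma> i) < \<tau> j" "lam (\<sigma> i') < \<tau> j'"
      by (auto simp: B_def)
    note n = D_n[OF D(1)] D_n[OF D(2)]
    have "lam (\<sigma> i) < \<tau> j' \<or> lam (\<sigma> i') < \<tau> j"
      using lam_anti[of i i'] lam_anti[of i' i] n le by linarith
    then show "(i, j') \<in> B \<or> (i', j) \<in> B"
      using mem n by (auto simp: B_def)
  qed
  ultimately show ?thesis
    by blast
qed

section \<open>Inversions\<close>

definition inversions :: "nat set \<Rightarrow> (nat \<Rightarrow> nat) \<Rightarrow> (nat \<times> nat) set" where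
  "inversions I w = {(i, j). i \<in> I \<and> j \<in> I \<and> i < j \<and> w j < w i}"

lemma rothe_diagram_eq_inversions:
  assumes "w permutes {1..n}"
  shows "rothe_diagram n w = {(i, w q) | i q. (i, q) \<in> inversions {1..n} w}"
proof -
  have "(i, j) \<in> rothe_diagram n w \<longleftrightarrow> (i, inv w j) \<in> inversions {1..n} w" for i j
    using permutes_in_image[OF permutes_inv[OF assms], of j]
    by (auto simp: rothe_diagram_def inversions_def permutes_inverses[OF assms])
  then show ?thesis
    using permutes_inverses[OF assms] by (auto, metis)
qed

lemma skew_complement_permute_columns:
  assumes "w permutes {1..n}"
  shows "skew_complement_up_to_perm n {(i, w q) | i q. (i, q) \<in> D} \<longleftrightarrow>
    skew_complement_up_to_perm n D"
proof -
  have step: "skew_complement_up_to_perm n E"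
    if v: "v permutes {1..n}" and skew: "skew_complement_up_to_perm n {(i, v q) | i q. (i, q) \<in> E}"
    for v E
  proof -
    from skew obtain \<sigma> \<tau> where \<sigma>\<tau>: "\<sigma> permutes {1..n}" "\<tau> permutes {1..n}"
      and compl: "is_skew_complement n {(\<sigma> i, \<tau> j) | i j. (i, j) \<in> {(i, v q) | i q. (i, q) \<in> E}}"
      unfolding skew_complement_up_to_perm_def by blast
    have "{(\<sigma> i, \<tau> j) | i j. (i, j) \<in> {(i, v q) | i q. (i, q) \<in> E}} =
        {(\<sigma> i, (\<tau> \<circ> v) j) | i j. (i, j) \<in> E}"
      by auto
    with compl have "is_skew_complement n {(\<sigma> i, (\<tau> \<circ> v) j) | i j. (i, j) \<in> E}"
      by simp
    then show ?thesis
      unfolding skew_complement_up_to_perm_def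
      using \<sigma>\<tau>(1) permutes_compose[OF v \<sigma>\<tau>(2)] by blast
  qed
  have "{(i, inv w j) | i j. (i, j) \<in> {(i, w q) | i q. (i, q) \<in> D}} = D"
    using permutes_inverses[OF assms] by (auto, metis)
  then show ?thesis
    using step[OF assms] step[OF permutes_inv[OF assms], of "{(i, w q) | i q. (i, q) \<in> D}"]
    by auto
qed

lemma skew_complement_rothe_iff:
  assumes "w permutes {1..n}"
  shows "skew_complement_up_to_perm n (rothe_diagram n w) \<longleftrightarrow>
    (\<exists>A B. inversions {1..n} w = A \<union> B \<and> ferrers A \<and> ferrers B \<and>
       Domain A \<inter> Domain B = {} \<and> Range A \<inter> Range B = {})"
    (is "_ \<longleftrightarrow> ?split")
proof -
  let ?D = "inversions {1..n} w"
  have sub: "?D \<subseteq> {1..n} \<times> {1..n}"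
    by (auto simp: inversions_def)
  have "skew_complement_up_to_perm n ?D \<longleftrightarrow> ?split"
  proof
    assume skew: "skew_complement_up_to_perm n ?D"
    show ?split
    proof (cases "n = 0")
      case True
      then have "?D = {}"
        by (auto simp: inversions_def)
      then show ?thesis
        by (intro exI[of _ "{}"]) (simp add: ferrers_def)
    next
      case False
      then show ?thesis
        by (intro ferrers_union_if_skew_complement[OF skew sub, of n 1])
          (auto simp: inversions_def)
    qed
  next
    assume ?split
    then show "skew_complement_up_to_perm n ?D"
      using skew_complement_if_ferrers_union sub by metis
  qed
  then show ?thesis
    by (simp add: rothe_diagram_eq_inversions[OF assms] skew_complement_permute_columns[OF assms])
qed

text \<open>
  Let \<open>(i, q)\<close> and \<open>(i', s)\<close> be inversions with \<open>i < i'\<close>, neither \<open>(i, s)\<close> nor \<open>(i', q)\<close> being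
  an inversion. Since \<open>i < i' < s\<close>, the first gives \<open>w i < w s\<close>, so \<open>w q < w i < w s < w i'\<close>, and
  then the second gives \<open>q < i'\<close>. Thus \<open>i < q < i' < s\<close> are the positions of a \<open>2143\<close>.
\<close>

lemma ferrers_inversions_iff_pattern:
  assumes "inj w"
  shows "ferrers (inversions I w) \<longleftrightarrow>
    \<not> (\<exists>i\<in>I. \<exists>q\<in>I. \<exists>r\<in>I. \<exists>s\<in>I. i < q \<and> q < r \<and> r < s \<and> w q < w i \<and> w i < w s \<and> w s < w r)"
    (is "_ \<longleftrightarrow> \<not> ?pattern")
proof
  assume ferrers: "ferrers (inversions I w)"
  show "\<not> ?pattern"
  proof
    assume ?pattern
    then obtain i q r s where *: "i \<in> I" "q \<in> I" "r \<in> I" "s \<in> I" "i < q" "q < r" "r < s"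
      "w q < w i" "w i < w s" "w s < w r"
      by blast
    then have "(i, q) \<in> inversions I w" "(r, s) \<in> inversions I w"
      by (auto simp: inversions_def)
    then show False
      using ferrersD[OF ferrers] * by (fastforce simp: inversions_def)
  qed
next
  assume no: "\<not> ?pattern"
  have main: "(i, s) \<in> inversions I w \<or> (r, q) \<in> inversions I w"
    if "(i, q) \<in> inversions I w" "(r, s) \<in> inversions I w" "i \<le> r" for i q r s
  proof (rule ccontr)
    assume neg: "\<not> ?thesis"
    have *: "i \<in> I" "q \<in> I" "r \<in> I" "s \<in> I" "i < q" "r < s" "w q < w i" "w s < w r"
      using that(1,2) by (auto simp: inversions_def)
    have "w i \<noteq> w s"
      using * that(3) by (auto simp: inj_eq[OF assms])
    then have "w i < w s"
      using neg * that(3) by (auto simp: inversions_def)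
    moreover have "q \<le> r"
      using neg * calculation by (auto simp: inversions_def)
    moreover have "q \<noteq> r"
      using * calculation by auto
    ultimately show False
      using no * by force
  qed
  show "ferrers (inversions I w)"
    unfolding ferrers_def using main by (meson nat_le_linear)
qed

lemma avoids_2143_map_upt_iff:
  "avoids_2143 (map w [m..<p]) \<longleftrightarrow>
    \<not> (\<exists>i\<in>{m..<p}. \<exists>q\<in>{m..<p}. \<exists>r\<in>{m..<p}. \<exists>s\<in>{m..<p}.
        i < q \<and> q < r \<and> r < s \<and> w q < w i \<and> w i < w s \<and> w s < w r)"
    (is "_ \<longleftrightarrow> \<not> ?pattern")
proof -
  have "(\<exists>i j k l. i < j \<and> j < k \<and> k < l \<and> l < p - m \<and>
      w (m + j) < w (m + i) \<and> w (m + i) < w (m + l) \<and> w (m + l) < w (m + k)) \<longleftrightarrow> ?pattern"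
    (is "?indexed \<longleftrightarrow> _")
  proof
    assume ?indexed
    then obtain i j k l where "i < j" "j < k" "k < l" "l < p - m"
      "w (m + j) < w (m + i)" "w (m + i) < w (m + l)" "w (m + l) < w (m + k)"
      by blast
    then show ?pattern
      by (intro bexI[of _ "m + i"] bexI[of _ "m + j"] bexI[of _ "m + k"] bexI[of _ "m + l"]) auto
  next
    assume ?pattern
    then obtain i q r s where "i \<in> {m..<p}" "s \<in> {m..<p}"
      "i < q" "q < r" "r < s" "w q < w i" "w i < w s" "w s < w r"
      by blast
    then show ?indexed
      by (intro exI[of _ "i - m"] exI[of _ "q - m"] exI[of _ "r - m"] exI[of _ "s - m"]) auto
  qed
  moreover have "avoids_2143 (map w [m..<p]) \<longleftrightarrow> \<not> ?indexed"
    unfolding avoids_2143_def by (intro arg_cong[where f = Not] ex_cong1) auto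
  ultimately show ?thesis
    by simp
qed

lemma ferrers_inversions_iff_avoids:
  "inj w \<Longrightarrow> ferrers (inversions {m..<p} w) \<longleftrightarrow> avoids_2143 (map w [m..<p])"
  by (simp add: ferrers_inversions_iff_pattern avoids_2143_map_upt_iff)

section \<open>Cutting the word\<close>

text \<open>
  Inversions sharing a left end, or sharing a right end, lie in the same part by disjointness of
  domains and ranges. The remaining case is the middle of a \<open>321\<close>: there the inversion formed by
  the two outer positions links the other two.
\<close>

lemma Field_disjoint_if_inversions_split:
  assumes split: "inversions I w = A \<union> B"
    and dom: "Domain A \<inter> Domain B = {}" and ran: "Range A \<inter> Range B = {}"
  shows "Field A \<inter> Field B = {}"
proof -
  have chain: False
    if "(x, e) \<in> X" "(e, y) \<in> Y" and XY: "X = A \<and> Y = B \<or> X = B \<and> Y = A" for x e y X Y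
  proof -
    have "(x, e) \<in> inversions I w" "(e, y) \<in> inversions I w"
      using that split by auto
    then have "(x, y) \<in> inversions I w"
      by (auto simp: inversions_def)
    then have "(x, y) \<in> X \<or> (x, y) \<in> Y"
      using split XY by auto
    then show False
      using that dom ran by auto
  qed
  show ?thesis
    unfolding Field_def using dom ran chain by blast
qed

text \<open>
  A position \<open>e\<close> lying between the two ends of an inversion forms an inversion with at least one of
  them. This is the reason why components of the inversion graph are intervals.
\<close>

lemma Field_between:
  assumes split: "inversions I w = A \<union> B" and inj: "inj w"
    and disj: "Field A \<inter> Field B = {}"
    and "(u, v) \<in> A" "u \<le> e" "e \<le> v" "e \<in> I"
  shows "e \<in> Field A"
proof (cases "e = u \<or> e = v")
  case True
  then show ?thesis
    using assms(4) by (auto simp: Field_def)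
next
  case False
  have uv: "u \<in> I" "v \<in> I" "u < v" "w v < w u"
    using assms(4) split by (auto simp: inversions_def set_eq_iff)
  have "(u, e) \<in> inversions I w \<or> (e, v) \<in> inversions I w"
    using False assms(5-7) uv by (auto simp: inversions_def)
  then have "(u, e) \<in> A \<or> (e, v) \<in> A"
    using split disj assms(4) by (fastforce simp: Field_def)
  then show ?thesis
    by (auto simp: Field_def)
qed

text \<open>
  The cut is made after the last position touched by the part containing the first touched position
  \<open>p\<close>. That part \<open>A\<close> touches all of \<open>{p..k}\<close>: applied to an inversion starting at \<open>p\<close> and one
  ending at \<open>k\<close>, the Ferrers condition yields either the inversion \<open>(p, k)\<close> or an overlap of the
  two intervals.
\<close>

lemma inversions_cut_aux:
  assumes split: "inversions {1..n} w = A \<union> B" and inj: "inj w"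
    and dom: "Domain A \<inter> Domain B = {}" and ran: "Range A \<inter> Range B = {}"
    and fer: "ferrers A"
    and first: "p \<in> Field A" "\<And>x. x \<in> Field (A \<union> B) \<Longrightarrow> p \<le> x"
  shows "\<exists>k\<le>n. A = inversions {1..<Suc k} w \<and> B = inversions {Suc k..<Suc n} w"
proof -
  have disj: "Field A \<inter> Field B = {}"
    using Field_disjoint_if_inversions_split[OF split dom ran] .
  have inv: "x \<in> {1..n}" "y \<in> {1..n}" "x < y" "w y < w x" if "(x, y) \<in> A \<union> B" for x y
    using that unfolding split[symmetric] by (auto simp: inversions_def)
  have Field_n: "Field A \<subseteq> {1..n}"
    using inv by (fastforce simp: Field_def)
  have fin: "finite (Field A)"
    using Field_n finite_subset by blast
  define k where "k = Max (Field A)"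
  have k: "k \<in> Field A" "\<And>x. x \<in> Field A \<Longrightarrow> x \<le> k"
    using fin first(1) by (auto simp: k_def intro: Max_in)
  have "k \<le> n"
    using k(1) Field_n by auto
  obtain q where pq: "(p, q) \<in> A"
  proof -
    have False if "(x, p) \<in> A" for x
      using that first(2)[of x] inv[of x p] by (auto simp: Field_def)
    then show thesis
      using first(1) that by (auto simp: Field_def)
  qed
  obtain z where zk: "(z, k) \<in> A"
  proof -
    have False if "(k, x) \<in> A" for x
      using that k(2)[of x] inv[of k x] by (auto simp: Field_def)
    then show thesis
      using k(1) that by (auto simp: Field_def)
  qed
  have interval: "e \<in> Field A" if "p \<le> e" "e \<le> k" for e
  proof -
    have "e \<in> {1..n}"
      using that inv[of p q] pq \<open>k \<le> n\<close> by auto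
    note between = Field_between[OF split inj disj _ _ _ this]
    from ferrersD[OF fer pq zk] show ?thesis
    proof
      assume "(p, k) \<in> A"
      then show ?thesis
        using between that by blast
    next
      assume "(z, q) \<in> A"
      then have "z < q"
        using inv by auto
      then show ?thesis
        using between[OF pq] between[OF zk] that by (meson less_imp_le nat_le_linear order_trans)
    qed
  qed
  have A_le: "x \<le> k \<and> y \<le> k" if "(x, y) \<in> A" for x y
    using that k(2) by (auto simp: Field_def)
  have B_gt: "k < x \<and> k < y" if "(x, y) \<in> B" for x y
  proof -
    have "x \<in> Field B" "y \<in> Field B"
      using that by (auto simp: Field_def)
    then show ?thesis
      using interval[of x] interval[of y] first(2)[of x] first(2)[of y] disj
      by (auto simp: not_le[symmetric])
  qed
  have low: "(x, y) \<in> A \<longleftrightarrow> (x, y) \<in> inversions {1..<Suc k} w" for x y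
  proof -
    have "(x, y) \<in> A \<longleftrightarrow> (x, y) \<in> A \<union> B \<and> x \<le> k \<and> y \<le> k"
      using A_le B_gt by fastforce
    then show ?thesis
      unfolding split[symmetric] using \<open>k \<le> n\<close> by (auto simp: inversions_def)
  qed
  have high: "(x, y) \<in> B \<longleftrightarrow> (x, y) \<in> inversions {Suc k..<Suc n} w" for x y
  proof -
    have "(x, y) \<in> B \<longleftrightarrow> (x, y) \<in> A \<union> B \<and> k < x \<and> k < y"
      using A_le B_gt by fastforce
    then show ?thesis
      unfolding split[symmetric] by (auto simp: inversions_def)
  qed
  show ?thesis
    using low high \<open>k \<le> n\<close> by auto
qed

lemma inversions_cut:
  assumes inj: "inj w"
  shows "(\<exists>A B. inversions {1..n} w = A \<union> B \<and> ferrers A \<and> ferrers B \<and>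
      Domain A \<inter> Domain B = {} \<and> Range A \<inter> Range B = {}) \<longleftrightarrow>
    (\<exists>k\<le>n. inversions {1..n} w = inversions {1..<Suc k} w \<union> inversions {Suc k..<Suc n} w \<and>
      ferrers (inversions {1..<Suc k} w) \<and> ferrers (inversions {Suc k..<Suc n} w))"
    (is "?split \<longleftrightarrow> ?cut")
proof
  assume ?split
  then obtain A B where AB: "inversions {1..n} w = A \<union> B" "ferrers A" "ferrers B"
    "Domain A \<inter> Domain B = {}" "Range A \<inter> Range B = {}"
    by blast
  show ?cut
  proof (cases "A \<union> B = {}")
    case True
    then have "inversions {Suc 0..<Suc n} w = {}"
      using AB(1) by (auto simp: inversions_def)
    then show ?thesis
      using AB(1) True by (intro exI[of _ 0]) (auto simp: ferrers_def inversions_def)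
  next
    case False
    define p where "p = (LEAST x. x \<in> Field (A \<union> B))"
    obtain x where "x \<in> Field (A \<union> B)"
      using False by (auto simp: Field_def)
    then have "p \<in> Field (A \<union> B)"
      unfolding p_def by (rule LeastI)
    have first: "p \<le> x" if "x \<in> Field (A \<union> B)" for x
      unfolding p_def using that by (rule Least_le)
    from \<open>p \<in> Field (A \<union> B)\<close> consider "p \<in> Field A" | "p \<in> Field B"
      by auto
    then show ?thesis
    proof cases
      case 1
      then show ?thesis
        using inversions_cut_aux[OF AB(1) inj AB(4,5,2) _ first] AB by blast
    next
      case 2
      have "inversions {1..n} w = B \<union> A" "Domain B \<inter> Domain A = {}" "Range B \<inter> Range A = {}"
        using AB by auto
      then show ?thesis
        using inversions_cut_aux[of n w B A, OF _ inj _ _ AB(3) 2] first AB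
        by (metis Un_commute)
    qed
  qed
next
  assume ?cut
  then obtain k where "inversions {1..n} w =
      inversions {1..<Suc k} w \<union> inversions {Suc k..<Suc n} w"
    "ferrers (inversions {1..<Suc k} w)" "ferrers (inversions {Suc k..<Suc n} w)"
    by blast
  moreover have "Domain (inversions {1..<Suc k} w) \<inter> Domain (inversions {Suc k..<Suc n} w) = {}"
    "Range (inversions {1..<Suc k} w) \<inter> Range (inversions {Suc k..<Suc n} w) = {}"
    by (auto simp: inversions_def)
  ultimately show ?split
    by blast
qed

lemma inversions_split_iff_less:
  assumes "inj w" "k \<le> n"
  shows "inversions {1..n} w = inversions {1..<Suc k} w \<union> inversions {Suc k..<Suc n} w \<longleftrightarrow>
    (\<forall>x\<in>set (map w [1..<Suc k]). \<forall>y\<in>set (map w [Suc k..<Suc n]). x < y)"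
    (is "?L \<longleftrightarrow> ?R")
proof
  assume L: ?L
  have "w i < w j" if "i \<in> {1..<Suc k}" "j \<in> {Suc k..<Suc n}" for i j
  proof (rule ccontr)
    assume "\<not> ?thesis"
    moreover have "w i \<noteq> w j"
      using that by (auto simp: inj_eq[OF assms(1)])
    ultimately have "(i, j) \<in> inversions {1..n} w"
      using that assms(2) by (auto simp: inversions_def)
    then show False
      using that unfolding L by (auto simp: inversions_def)
  qed
  then show ?R
    by auto
next
  assume ?R
  then have less: "w i < w j" if "i \<in> {1..k}" "j \<in> {Suc k..n}" for i j
    using that by (auto simp del: upt_Suc)
  have "j \<le> k" if "i \<in> {1..n}" "j \<in> {1..n}" "w j < w i" "i \<le> k" for i j
    using that less[of i j] by fastforce
  then show ?L
    using assms(2) by (fastforce simp: inversions_def)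
qed

lemma permutation_word_append_iff:
  assumes "k \<le> n"
  shows "length a = k \<and> length b = n - k \<and> permutation_word n w = a @ b \<longleftrightarrow>
    a = map w [1..<Suc k] \<and> b = map w [Suc k..<Suc n]"
proof -
  have "[1..<Suc n] = [1..<Suc k] @ [Suc k..<Suc n]"
    using upt_add_eq_append[of 1 "Suc k" "n - k"] assms by simp
  then have "permutation_word n w = map w [1..<Suc k] @ map w [Suc k..<Suc n]"
    by (simp only: permutation_word_def map_append)
  then show ?thesis
    by (auto simp: append_eq_append_conv simp del: upt_Suc)
qed

theorem theorem5p4:
  fixes n :: nat and w :: "nat \<Rightarrow> nat"
  assumes "w permutes {1..n}"
  shows "skew_complement_up_to_perm n (rothe_diagram n w) \<longleftrightarrow>
    (\<exists>k a b. k \<le> n \<and> length a = k \<and> length b = n - k \<and>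
       permutation_word n w = a @ b \<and>
       (\<forall>x\<in>set a. \<forall>y\<in>set b. x < y) \<and>
       avoids_2143 a \<and> avoids_2143 b)"
proof -
  have inj: "inj w"
    using assms by (rule permutes_inj)
  let ?a = "\<lambda>k. map w [1..<Suc k]" and ?b = "\<lambda>k. map w [Suc k..<Suc n]"
  have "skew_complement_up_to_perm n (rothe_diagram n w) \<longleftrightarrow>
    (\<exists>k\<le>n. (\<forall>x\<in>set (?a k). \<forall>y\<in>set (?b k). x < y) \<and> avoids_2143 (?a k) \<and> avoids_2143 (?b k))"
    unfolding skew_complement_rothe_iff[OF assms] inversions_cut[OF inj]
      ferrers_inversions_iff_avoids[OF inj]
    using inversions_split_iff_less[OF inj] by blast
  also have "\<dots> \<longleftrightarrow> (\<exists>k\<le>n. \<exists>a b.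
      (length a = k \<and> length b = n - k \<and> permutation_word n w = a @ b) \<and>
      (\<forall>x\<in>set a. \<forall>y\<in>set b. x < y) \<and> avoids_2143 a \<and> avoids_2143 b)"
  proof (intro ex_cong1 conj_cong refl)
    fix k assume "k \<le> n"
    show "((\<forall>x\<in>set (?a k). \<forall>y\<in>set (?b k). x < y) \<and> avoids_2143 (?a k) \<and> avoids_2143 (?b k)) =
      (\<exists>a b. (length a = k \<and> length b = n - k \<and> permutation_word n w = a @ b) \<and>
        (\<forall>x\<in>set a. \<forall>y\<in>set b. x < y) \<and> avoids_2143 a \<and> avoids_2143 b)"
      unfolding permutation_word_append_iff[OF \<open>k \<le> n\<close>] by blast
  qed
  also have "\<dots> \<longleftrightarrow> (\<exists>k a b. k \<le> n \<and> length a = k \<and> length b = n - k \<and>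
       permutation_word n w = a @ b \<and>
       (\<forall>x\<in>set a. \<forall>y\<in>set b. x < y) \<and> avoids_2143 a \<and> avoids_2143 b)"
    by blast
  finally show ?thesis .
qed

end
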